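(* Let $\pi\in\mathcal P(\mathcal X)$, let $P_1,\dots,P_n\in\mathcal L(\mathcal X)$ be $\pi$-stationary, let $(S_1,\dots,S_m)$ be a partition of $[d]$, and let $$h(\mathbf w)=-\sum_{i=1}^nw_iD_{\mathrm{KL}}^\pi\big(P_i\|\otimes_{k=1}^m\overline P(\mathbf w)^{(S_k)}\big),\qquad\mathbf w\in\mathcal S_n.$$ A subgradient of $h$ at $\mathbf v\in\mathcal S_n$ is given by $\mathbf g=\mathbf g(\mathbf v)=(g_1,\dots,g_n)\in\mathbb R^n$, where for all $i\in\{1,\dots,n\}$ $$g_i=g_i(\mathbf v)=D_{\mathrm{KL}}^\pi\big(P_n\|\otimes_{k=1}^m\overline P(\mathbf v)^{(S_k)}\big)-D_{\mathrm{KL}}^\pi\big(P_i\|\otimes_{k=1}^m\overline P(\mathbf v)^{(S_k)}\big).$$ It satisfies, for all $\mathbf w,\mathbf v\in\mathcal S_n$, $$h(\mathbf w)\ge h(\mathbf v)+\sum_{i=1}^ng_i(\mathbf v)\,(w_i-v_i).$$ Moreover, $$\|\mathbf g(\mathbf v)\|_2^2=\sum_{i=1}^ng_i^2\le n\left(|\mathcal X|\sup_{\mathbf v\in\mathcal S_n;\ i\in\{1,\dots,n\};\ x,y\in\mathcal X:\,P_i(x,y)>0}P_i(x,y)\ln\frac{P_i(x,y)}{(\otimes_{k=1}^m\overline P(\mathbf v)^{(S_k)})(x,y)}\right)^2=:B.$$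
   Context: $[d]=\{1,\dots,d\}$; $\mathcal X=\mathcal X^{(1)}\times\cdots\times\mathcal X^{(d)}$ is a finite product state space; for $S\subseteq[d]$, $\mathcal X^{(S)}=\times_{i\in S}\mathcal X^{(i)}$, $-S=[d]\setminus S$. $\mathcal L(\mathcal Y)$ is the set of transition matrices on $\mathcal Y$. $\mathcal P(\mathcal X)$ is the set of probability mass functions on $\mathcal X$ with full support. $P$ is $\pi$-stationary if $\pi P=\pi$. $\mathcal S_n=\{\mathbf w\in\mathbb R_+^n:\sum_iw_i=1\}$, $\overline P(\mathbf w)=\sum_{i=1}^nw_iP_i$. For $\pi$-stationary $P\in\mathcal L(\mathcal X)$, the keep-$S$-in matrix is $P^{(S)}\in\mathcal L(\mathcal X^{(S)})$, $$P^{(S)}(x^{(S)},y^{(S)})=\frac{\sum_{x^{(-S)},y^{(-S)}}\pi(x)P(x,y)}{\sum_{x^{(-S)}}\pi(x)},\qquad P^{(\emptyset)}=1.$$ $(\otimes_{j=1}^mM_j)(x,y)=\prod_jM_j(x^{(S_j)},y^{(S_j)})$. $D_{\mathrm{KL}}^{\pi}(M\|L)=\sum_x\pi(x)\sum_yM(x,y)\ln\frac{M(x,y)}{L(x,y)}$, with $0\ln\frac0a:=0$ for $a\in[0,1]$.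
   Formalization: At v with some v_i=0 a divergence can be infinite, so g(v) need not lie in R^n; g(v) is shown real if all v_i>0 and a subgradient wherever it is real, and the inequality (in extended reals) is claimed where the divergence of P_n at v is finite. *)

theory Defs
  imports "HOL-Probability.Probability"
begin

text \<open>
  A state of \<open>\<X>\<^sup>(\<^sup>S\<^sup>)\<close> is an element of \<open>Pi\<^sub>E S X\<close>, so the restriction \<open>x\<^sup>(\<^sup>S\<^sup>)\<close> is
  \<open>restrict x S\<close>, and \<open>merge S (-S) (a, u)\<close> is the state \<open>x\<close> with \<open>x\<^sup>(\<^sup>S\<^sup>) = a\<close> and
  \<open>x\<^sup>(\<^sup>-\<^sup>S\<^sup>) = u\<close>. Matrices are real functions of two states; only their values on the state
  space matter.
\<close>

definition transition_matrix :: "'s set \<Rightarrow> ('s \<Rightarrow> 's \<Rightarrow> real) \<Rightarrow> bool" where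
  "transition_matrix Y M \<longleftrightarrow>
     (\<forall>x\<in>Y. (\<forall>y\<in>Y. 0 \<le> M x y) \<and> (\<Sum>y\<in>Y. M x y) = 1)"

definition stationary :: "'s set \<Rightarrow> 's pmf \<Rightarrow> ('s \<Rightarrow> 's \<Rightarrow> real) \<Rightarrow> bool" where
  "stationary Y \<pi> M \<longleftrightarrow> (\<forall>y\<in>Y. (\<Sum>x\<in>Y. pmf \<pi> x * M x y) = pmf \<pi> y)"

definition keep_in ::
  "nat \<Rightarrow> (nat \<Rightarrow> 'a set) \<Rightarrow> (nat \<Rightarrow> 'a) pmf \<Rightarrow> ((nat \<Rightarrow> 'a) \<Rightarrow> (nat \<Rightarrow> 'a) \<Rightarrow> real)
     \<Rightarrow> nat set \<Rightarrow> (nat \<Rightarrow> 'a) \<Rightarrow> (nat \<Rightarrow> 'a) \<Rightarrow> real" where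
  "keep_in d X \<pi> P S a b =
     (let T = {1..d} - S in
       (\<Sum>u\<in>Pi\<^sub>E T X. \<Sum>v\<in>Pi\<^sub>E T X. pmf \<pi> (merge S T (a, u)) * P (merge S T (a, u)) (merge S T (b, v)))
       / (\<Sum>u\<in>Pi\<^sub>E T X. pmf \<pi> (merge S T (a, u))))"

definition tensor ::
  "nat \<Rightarrow> (nat \<Rightarrow> nat set) \<Rightarrow> (nat \<Rightarrow> (nat \<Rightarrow> 'a) \<Rightarrow> (nat \<Rightarrow> 'a) \<Rightarrow> real)
     \<Rightarrow> (nat \<Rightarrow> 'a) \<Rightarrow> (nat \<Rightarrow> 'a) \<Rightarrow> real" where
  "tensor m S M x y = (\<Prod>k\<in>{1..m}. M k (restrict x (S k)) (restrict y (S k)))"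

text \<open>
  The divergence is extended-real valued: the summand is \<open>\<infinity>\<close> when \<open>a > 0\<close> and \<open>b = 0\<close>
  (whereas \<open>ln (a / 0) = 0\<close> in HOL). On \<open>ereal\<close> we have \<open>0 * \<infinity> = 0\<close> and \<open>\<infinity> - \<infinity> = \<infinity>\<close>.
\<close>

definition xln_ratio :: "real \<Rightarrow> real \<Rightarrow> ereal" where
  "xln_ratio a b = (if a = 0 then 0 else if b = 0 then \<infinity> else ereal (a * ln (a / b)))"

definition KL :: "'s set \<Rightarrow> 's pmf \<Rightarrow> ('s \<Rightarrow> 's \<Rightarrow> real) \<Rightarrow> ('s \<Rightarrow> 's \<Rightarrow> real) \<Rightarrow> ereal" where
  "KL Y \<pi> M L = (\<Sum>x\<in>Y. ereal (pmf \<pi> x) * (\<Sum>y\<in>Y. xln_ratio (M x y) (L x y)))"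

text \<open>Vectors in \<open>\<real>\<^sup>n\<close> are functions on \<open>nat\<close> of which only the values on \<open>{1..n}\<close> are used.\<close>

definition simplex_weights :: "nat \<Rightarrow> (nat \<Rightarrow> real) set" where
  "simplex_weights n = {w. (\<forall>i\<in>{1..n}. 0 \<le> w i) \<and> (\<Sum>i\<in>{1..n}. w i) = 1}"

definition mixture :: "nat \<Rightarrow> (nat \<Rightarrow> 's \<Rightarrow> 's \<Rightarrow> real) \<Rightarrow> (nat \<Rightarrow> real) \<Rightarrow> 's \<Rightarrow> 's \<Rightarrow> real" where
  "mixture n P w x y = (\<Sum>i\<in>{1..n}. w i * P i x y)"

definition prod_mixture ::
  "nat \<Rightarrow> (nat \<Rightarrow> 'a set) \<Rightarrow> (nat \<Rightarrow> 'a) pmf \<Rightarrow> nat \<Rightarrow> (nat \<Rightarrow> (nat \<Rightarrow> 'a) \<Rightarrow> (nat \<Rightarrow> 'a) \<Rightarrow> real)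
     \<Rightarrow> nat \<Rightarrow> (nat \<Rightarrow> nat set) \<Rightarrow> (nat \<Rightarrow> real) \<Rightarrow> (nat \<Rightarrow> 'a) \<Rightarrow> (nat \<Rightarrow> 'a) \<Rightarrow> real" where
  "prod_mixture d X \<pi> n P m S w = tensor m S (\<lambda>k. keep_in d X \<pi> (mixture n P w) (S k))"

definition div_to_prod ::
  "nat \<Rightarrow> (nat \<Rightarrow> 'a set) \<Rightarrow> (nat \<Rightarrow> 'a) pmf \<Rightarrow> nat \<Rightarrow> (nat \<Rightarrow> (nat \<Rightarrow> 'a) \<Rightarrow> (nat \<Rightarrow> 'a) \<Rightarrow> real)
     \<Rightarrow> nat \<Rightarrow> (nat \<Rightarrow> nat set) \<Rightarrow> (nat \<Rightarrow> real) \<Rightarrow> nat \<Rightarrow> ereal" where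
  "div_to_prod d X \<pi> n P m S w i = KL (Pi\<^sub>E {1..d} X) \<pi> (P i) (prod_mixture d X \<pi> n P m S w)"

definition h_fun ::
  "nat \<Rightarrow> (nat \<Rightarrow> 'a set) \<Rightarrow> (nat \<Rightarrow> 'a) pmf \<Rightarrow> nat \<Rightarrow> (nat \<Rightarrow> (nat \<Rightarrow> 'a) \<Rightarrow> (nat \<Rightarrow> 'a) \<Rightarrow> real)
     \<Rightarrow> nat \<Rightarrow> (nat \<Rightarrow> nat set) \<Rightarrow> (nat \<Rightarrow> real) \<Rightarrow> ereal" where
  "h_fun d X \<pi> n P m S w = - (\<Sum>i\<in>{1..n}. ereal (w i) * div_to_prod d X \<pi> n P m S w i)"

definition g_vec ::
  "nat \<Rightarrow> (nat \<Rightarrow> 'a set) \<Rightarrow> (nat \<Rightarrow> 'a) pmf \<Rightarrow> nat \<Rightarrow> (nat \<Rightarrow> (nat \<Rightarrow> 'a) \<Rightarrow> (nat \<Rightarrow> 'a) \<Rightarrow> real)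
     \<Rightarrow> nat \<Rightarrow> (nat \<Rightarrow> nat set) \<Rightarrow> (nat \<Rightarrow> real) \<Rightarrow> nat \<Rightarrow> ereal" where
  "g_vec d X \<pi> n P m S v i = div_to_prod d X \<pi> n P m S v n - div_to_prod d X \<pi> n P m S v i"

definition is_subgradient ::
  "nat \<Rightarrow> (nat \<Rightarrow> real) set \<Rightarrow> ((nat \<Rightarrow> real) \<Rightarrow> ereal) \<Rightarrow> (nat \<Rightarrow> real) \<Rightarrow> (nat \<Rightarrow> real) \<Rightarrow> bool" where
  "is_subgradient n C f v g \<longleftrightarrow>
     v \<in> C \<and> \<bar>f v\<bar> \<noteq> \<infinity> \<and> (\<forall>w\<in>C. f w \<ge> f v + ereal (\<Sum>i\<in>{1..n}. g i * (w i - v i)))"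

text \<open>The supremum is taken in \<open>ereal\<close>, hence may be \<open>\<infinity>\<close>.\<close>

definition B_bound ::
  "nat \<Rightarrow> (nat \<Rightarrow> 'a set) \<Rightarrow> (nat \<Rightarrow> 'a) pmf \<Rightarrow> nat \<Rightarrow> (nat \<Rightarrow> (nat \<Rightarrow> 'a) \<Rightarrow> (nat \<Rightarrow> 'a) \<Rightarrow> real)
     \<Rightarrow> nat \<Rightarrow> (nat \<Rightarrow> nat set) \<Rightarrow> ereal" where
  "B_bound d X \<pi> n P m S =
     ereal (real n) *
     (ereal (real (card (Pi\<^sub>E {1..d} X))) *
      Sup {xln_ratio (P i x y) (prod_mixture d X \<pi> n P m S v x y) | v i x y.
             v \<in> simplex_weights n \<and> i \<in> {1..n} \<and> x \<in> Pi\<^sub>E {1..d} X \<and> y \<in> Pi\<^sub>E {1..d} X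
             \<and> P i x y > 0})\<^sup>2"

end

theory Submission
  imports Defs
begin

text \<open>
  Write \<open>Q\<^sub>v\<close> for the product of the keep-in matrices of the mixture with weights \<open>v\<close>,
  \<open>D\<^sub>i(v)\<close> for the divergence of \<open>P\<^sub>i\<close> from \<open>Q\<^sub>v\<close>, and
  \<open>F(w, v) = \<Sum>\<^sub>i w\<^sub>i D\<^sub>i(v)\<close>, so that \<open>h(w) = - F(w, w)\<close>.

  The subgradient inequality rests on a Pythagorean identity. In \<open>F(w, v) - F(w, w)\<close> the terms
  \<open>P\<^sub>i ln P\<^sub>i\<close> cancel, and what is left is the average of \<open>ln (Q\<^sub>w / Q\<^sub>v)\<close> under the pair law
  \<open>\<pi>(x) M(x, y)\<close>, where \<open>M\<close> is the \<open>w\<close>-mixture. This logarithm is a sum with one summand per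
  block, and each summand depends only on the coordinates in its block. Its average can therefore
  be taken under the pair law that the block inherits, and that law is the marginal of \<open>\<pi>\<close> times
  the keep-in matrix of \<open>M\<close> (lemma \<open>sum_keep_in\<close>). Hence the difference is a sum over the blocks
  of the divergences of the keep-in matrices of the two mixtures
  (\<open>weighted_Dr_difference\<close>), which is nonnegative by Gibbs' inequality: among the \<open>Q\<^sub>v\<close>, the matrix \<open>Q\<^sub>w\<close>
  minimises \<open>v \<mapsto> F(w, v)\<close> (\<open>own_projection_optimal\<close>).

  So \<open>h(w) \<ge> - F(w, v)\<close>, with equality at \<open>w = v\<close>. The right-hand side is linear in \<open>w\<close>, which makes
  \<open>(- D\<^sub>i(v))\<^sub>i\<close> a subgradient at \<open>v\<close>; adding the constant \<open>D\<^sub>n(v)\<close> to every entry changes nothing,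
  because \<open>w - v\<close> sums to zero.

  For the norm bound, \<open>Q\<^sub>v\<close> is row-stochastic, so \<open>D\<^sub>i(v) \<ge> 0\<close>. Averaging over \<open>\<pi>\<close> and bounding each
  entry of a row by the supremum gives \<open>D\<^sub>i(v) \<le> \<bar>\<X>\<bar> sup\<close>. Thus every \<open>g\<^sub>i\<close> is a difference of two
  numbers in \<open>[0, \<bar>\<X>\<bar> sup]\<close> (\<open>D_le_card_mult_bound\<close>, \<open>sum_g_power2_le_B\<close>).

  Divergences may be infinite. \<open>D\<^sub>i(v)\<close> is finite exactly if the support of \<open>P\<^sub>i\<close> lies in that of
  \<open>Q\<^sub>v\<close>, and since \<open>Q\<^sub>v\<close> is positive wherever the \<open>v\<close>-mixture is, this holds whenever \<open>v\<^sub>i > 0\<close>.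
  That is why \<open>h\<close> is finite on the whole simplex. If \<open>w\<close> puts mass on an index with infinite
  divergence while \<open>D\<^sub>n(v)\<close> is finite, the affine lower bound is \<open>- \<infinity>\<close> and the inequality is trivial.
\<close>

(* Index ranges {1..d} occur inside terms that have to match syntactically; rewriting 1 to Suc 0
   would prevent this. *)
declare One_nat_def [simp del]

section \<open>Sums over product spaces\<close>

lemma merge_in_PiE:
  assumes "a \<in> Pi\<^sub>E A X" "u \<in> Pi\<^sub>E B X"
  shows "merge A B (a, u) \<in> Pi\<^sub>E (A \<union> B) X"
  using assms by (auto simp: PiE_iff merge_def extensional_def)

lemma sum_PiE_Un:
  fixes f :: "('i \<Rightarrow> 'a) \<Rightarrow> real"
  assumes "A \<inter> B = {}"
  shows "(\<Sum>x\<in>Pi\<^sub>E (A \<union> B) X. f x) = (\<Sum>a\<in>Pi\<^sub>E A X. \<Sum>u\<in>Pi\<^sub>E B X. f (merge A B (a, u)))"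
proof -
  have "bij_betw (merge A B) (Pi\<^sub>E A X \<times> Pi\<^sub>E B X) (Pi\<^sub>E (A \<union> B) X)"
    by (rule bij_betw_byWitness[where f' = "\<lambda>x. (restrict x A, restrict x B)"])
       (use assms in \<open>auto simp: PiE_iff merge_def extensional_def restrict_def fun_eq_iff\<close>)
  from sum.reindex_bij_betw[OF this, of f] show ?thesis
    by (simp add: sum.cartesian_product case_prod_unfold)
qed

text \<open>
  Splitting off one block at a time, a sum over a product space of a product of functions of
  separate blocks factorises. This is what makes a tensor product of transition matrices a
  transition matrix.
\<close>

lemma sum_PiE_prod_blocks:
  fixes f :: "'k \<Rightarrow> ('i \<Rightarrow> 'a) \<Rightarrow> real"
  assumes "finite K" and "disjoint_family_on S K"
  shows "(\<Sum>y\<in>Pi\<^sub>E (\<Union>k\<in>K. S k) X. \<Prod>k\<in>K. f k (restrict y (S k)))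
       = (\<Prod>k\<in>K. \<Sum>b\<in>Pi\<^sub>E (S k) X. f k b)"
  using assms
proof (induction K rule: finite_induct)
  case empty
  then show ?case by simp
next
  case (insert j K)
  let ?U = "\<Union>k\<in>K. S k"
  have disj: "S j \<inter> ?U = {}"
    using insert.prems insert.hyps by (auto simp: disjoint_family_on_def)
  have sub: "restrict (merge (S j) ?U (b, u)) (S k) = restrict u (S k)" if "k \<in> K" for k b u
    using disj that by (auto simp: merge_def restrict_def fun_eq_iff)
  have own: "restrict (merge (S j) ?U (b, u)) (S j) = b" if "b \<in> Pi\<^sub>E (S j) X" for b u
    using that by (auto simp: merge_def restrict_def fun_eq_iff PiE_iff extensional_def)
  have IH: "(\<Sum>y\<in>Pi\<^sub>E ?U X. \<Prod>k\<in>K. f k (restrict y (S k))) = (\<Prod>k\<in>K. \<Sum>b\<in>Pi\<^sub>E (S k) X. f k b)"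
    by (rule insert.IH) (use insert.prems in \<open>auto simp: disjoint_family_on_def\<close>)
  have "(\<Sum>y\<in>Pi\<^sub>E (\<Union>k\<in>insert j K. S k) X. \<Prod>k\<in>insert j K. f k (restrict y (S k)))
      = (\<Sum>b\<in>Pi\<^sub>E (S j) X. \<Sum>u\<in>Pi\<^sub>E ?U X. f j b * (\<Prod>k\<in>K. f k (restrict u (S k))))"
    using insert.hyps by (simp add: sum_PiE_Un[OF disj] sub own)
  also have "\<dots> = (\<Sum>b\<in>Pi\<^sub>E (S j) X. f j b) * (\<Prod>k\<in>K. \<Sum>b\<in>Pi\<^sub>E (S k) X. f k b)"
    by (simp add: sum_product IH[symmetric])
  finally show ?case
    by (simp only: prod.insert[OF insert.hyps])
qed

section \<open>Relative entropy\<close>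

text \<open>
  From \<open>ln t \<le> t - 1\<close> at \<open>t = q / p\<close> one gets \<open>p - q \<le> p ln (p / q)\<close> entry by entry.
\<close>

lemma Gibbs_inequality:
  fixes p q :: "'b \<Rightarrow> real"
  assumes "\<And>y. y \<in> Y \<Longrightarrow> 0 \<le> p y" "\<And>y. y \<in> Y \<Longrightarrow> 0 \<le> q y"
    and "\<And>y. y \<in> Y \<Longrightarrow> p y \<noteq> 0 \<Longrightarrow> q y \<noteq> 0"
    and "sum q Y \<le> sum p Y"
  shows "0 \<le> (\<Sum>y\<in>Y. p y * ln (p y / q y))"
proof -
  have "p y - q y \<le> p y * ln (p y / q y)" if "y \<in> Y" for y
  proof (cases "p y = 0")
    case False
    then have pos: "0 < p y" "0 < q y"
      using assms(1-3)[OF that] by auto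
    then have "ln (q y / p y) \<le> q y / p y - 1"
      by (intro ln_le_minus_one) simp
    then have "p y * ln (q y / p y) \<le> q y - p y"
      using pos by (simp add: field_simps)
    then show ?thesis
      using pos by (simp add: ln_div algebra_simps)
  qed (use assms(2)[OF that] in simp)
  then have "(\<Sum>y\<in>Y. p y - q y) \<le> (\<Sum>y\<in>Y. p y * ln (p y / q y))"
    by (rule sum_mono)
  then show ?thesis
    using assms(4) by (simp add: sum_subtractf)
qed

definition abs_cont_on :: "'s set \<Rightarrow> ('s \<Rightarrow> 's \<Rightarrow> real) \<Rightarrow> ('s \<Rightarrow> 's \<Rightarrow> real) \<Rightarrow> bool" where
  "abs_cont_on Y M L \<longleftrightarrow> (\<forall>x\<in>Y. \<forall>y\<in>Y. M x y \<noteq> 0 \<longrightarrow> L x y \<noteq> 0)"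

text \<open>
  With \<open>a / 0 = 0\<close> and \<open>ln 0 = 0\<close> this formula always has a finite value, even where \<open>KL\<close> is
  infinite; it is used under absolute continuity of \<open>M\<close> with respect to \<open>L\<close>.
\<close>

definition KL_real :: "'s set \<Rightarrow> 's pmf \<Rightarrow> ('s \<Rightarrow> 's \<Rightarrow> real) \<Rightarrow> ('s \<Rightarrow> 's \<Rightarrow> real) \<Rightarrow> real" where
  "KL_real Y \<pi> M L = (\<Sum>x\<in>Y. pmf \<pi> x * (\<Sum>y\<in>Y. M x y * ln (M x y / L x y)))"

lemma KL_eq_KL_real:
  assumes "abs_cont_on Y M L"
  shows "KL Y \<pi> M L = ereal (KL_real Y \<pi> M L)"
proof -
  have "xln_ratio (M x y) (L x y) = ereal (M x y * ln (M x y / L x y))" if "x \<in> Y" "y \<in> Y" for x y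
    using assms that by (auto simp: xln_ratio_def abs_cont_on_def zero_ereal_def)
  then show ?thesis
    by (simp add: KL_def KL_real_def)
qed

lemma KL_eq_PInfty:
  assumes "finite Y" "Y \<subseteq> set_pmf \<pi>" "\<not> abs_cont_on Y M L"
  shows "KL Y \<pi> M L = \<infinity>"
proof -
  obtain x y where xy: "x \<in> Y" "y \<in> Y" "M x y \<noteq> 0" "L x y = 0"
    using assms(3) by (auto simp: abs_cont_on_def)
  then have "xln_ratio (M x y) (L x y) = \<infinity>"
    by (simp add: xln_ratio_def)
  then have "(\<Sum>y\<in>Y. xln_ratio (M x y) (L x y)) = \<infinity>"
    using xy(2) assms(1) by (auto simp: sum_Pinfty)
  moreover have "0 < pmf \<pi> x"
    using xy(1) assms(2) by (auto intro: pmf_positive)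
  ultimately have "ereal (pmf \<pi> x) * (\<Sum>y\<in>Y. xln_ratio (M x y) (L x y)) = \<infinity>"
    by simp
  then show ?thesis
    using xy(1) assms(1) unfolding KL_def by (auto simp: sum_Pinfty)
qed

lemma KL_real_nonneg:
  assumes "\<And>x y. x \<in> Y \<Longrightarrow> y \<in> Y \<Longrightarrow> 0 \<le> M x y" "\<And>x y. x \<in> Y \<Longrightarrow> y \<in> Y \<Longrightarrow> 0 \<le> L x y"
    and "abs_cont_on Y M L" "\<And>x. x \<in> Y \<Longrightarrow> (\<Sum>y\<in>Y. L x y) \<le> (\<Sum>y\<in>Y. M x y)"
  shows "0 \<le> KL_real Y \<pi> M L"
  unfolding KL_real_def
  by (intro sum_nonneg mult_nonneg_nonneg Gibbs_inequality)
     (use assms in \<open>auto simp: abs_cont_on_def\<close>)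

section \<open>Keep-in matrices\<close>

locale product_chain =
  fixes d :: nat and X :: "nat \<Rightarrow> 'a set" and \<pi> :: "(nat \<Rightarrow> 'a) pmf"
  assumes finite_factor: "i \<in> {1..d} \<Longrightarrow> finite (X i)"
    and full_support: "set_pmf \<pi> = Pi\<^sub>E {1..d} X"
begin

abbreviation \<Omega> :: "(nat \<Rightarrow> 'a) set" where
  "\<Omega> \<equiv> Pi\<^sub>E {1..d} X"

abbreviation (input) nonneg_on :: "((nat \<Rightarrow> 'a) \<Rightarrow> (nat \<Rightarrow> 'a) \<Rightarrow> real) \<Rightarrow> bool" where
  "nonneg_on M \<equiv> (\<forall>x\<in>\<Omega>. \<forall>y\<in>\<Omega>. 0 \<le> M x y)"

definition marginal :: "nat set \<Rightarrow> (nat \<Rightarrow> 'a) \<Rightarrow> real" where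
  "marginal S a = (\<Sum>u\<in>Pi\<^sub>E ({1..d} - S) X. pmf \<pi> (merge S ({1..d} - S) (a, u)))"

lemma finite_PiE_sub: "T \<subseteq> {1..d} \<Longrightarrow> finite (Pi\<^sub>E T X)"
  by (rule finite_PiE) (use finite_factor in \<open>auto intro: finite_subset\<close>)

lemma finite_states: "finite \<Omega>"
  by (simp add: finite_PiE_sub)

lemma states_nonempty: "\<Omega> \<noteq> {}"
  using set_pmf_not_empty[of \<pi>] full_support by simp

lemma PiE_sub_nonempty: "T \<subseteq> {1..d} \<Longrightarrow> Pi\<^sub>E T X \<noteq> {}"
  using states_nonempty by (auto simp: PiE_eq_empty_iff)

lemma pmf_pos: "x \<in> \<Omega> \<Longrightarrow> 0 < pmf \<pi> x"
  using full_support by (auto intro: pmf_positive)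

lemma sum_pmf: "(\<Sum>x\<in>\<Omega>. pmf \<pi> x) = 1"
  by (rule sum_pmf_eq_1[OF finite_states]) (simp add: full_support)

lemma merge_in_states:
  assumes "S \<subseteq> {1..d}" "a \<in> Pi\<^sub>E S X" "u \<in> Pi\<^sub>E ({1..d} - S) X"
  shows "merge S ({1..d} - S) (a, u) \<in> \<Omega>"
  using merge_in_PiE[OF assms(2,3)] assms(1) by (simp add: Un_absorb1)

lemma restrict_merge_states:
  assumes "a \<in> Pi\<^sub>E S X"
  shows "restrict (merge S ({1..d} - S) (a, u)) S = a"
  using assms by (auto simp: merge_def restrict_def fun_eq_iff PiE_iff extensional_def)

lemma merge_restrict_states:
  assumes "S \<subseteq> {1..d}" "x \<in> \<Omega>"
  shows "merge S ({1..d} - S) (restrict x S, restrict x ({1..d} - S)) = x"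
  using assms by (auto simp: merge_def restrict_def fun_eq_iff PiE_iff extensional_def)

lemma restrict_in_PiE_sub:
  assumes "T \<subseteq> {1..d}" "x \<in> \<Omega>"
  shows "restrict x T \<in> Pi\<^sub>E T X"
  using assms by (auto simp: PiE_iff)

lemma sum_states_split:
  fixes f :: "(nat \<Rightarrow> 'a) \<Rightarrow> real"
  assumes "S \<subseteq> {1..d}"
  shows "(\<Sum>x\<in>\<Omega>. f x) = (\<Sum>a\<in>Pi\<^sub>E S X. \<Sum>u\<in>Pi\<^sub>E ({1..d} - S) X. f (merge S ({1..d} - S) (a, u)))"
proof -
  have "S \<union> ({1..d} - S) = {1..d}"
    using assms by auto
  then show ?thesis
    using sum_PiE_Un[of S "{1..d} - S" f X] by simp
qed

lemma marginal_pos: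
  assumes "S \<subseteq> {1..d}" "a \<in> Pi\<^sub>E S X"
  shows "0 < marginal S a"
  unfolding marginal_def
  by (intro sum_pos finite_PiE_sub PiE_sub_nonempty pmf_pos merge_in_states assms) auto

lemma marginal_mult_keep_in:
  assumes "S \<subseteq> {1..d}" "a \<in> Pi\<^sub>E S X"
  shows "marginal S a * keep_in d X \<pi> M S a b =
    (\<Sum>u\<in>Pi\<^sub>E ({1..d} - S) X. \<Sum>v\<in>Pi\<^sub>E ({1..d} - S) X.
       pmf \<pi> (merge S ({1..d} - S) (a, u)) *
       M (merge S ({1..d} - S) (a, u)) (merge S ({1..d} - S) (b, v)))"
  using marginal_pos[OF assms] by (simp add: keep_in_def Let_def marginal_def)

lemma keep_in_nonneg:
  assumes "S \<subseteq> {1..d}" "nonneg_on M" "a \<in> Pi\<^sub>E S X" "b \<in> Pi\<^sub>E S X"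
  shows "0 \<le> keep_in d X \<pi> M S a b"
proof -
  have "0 \<le> marginal S a * keep_in d X \<pi> M S a b"
    unfolding marginal_mult_keep_in[OF assms(1,3)]
    by (intro sum_nonneg mult_nonneg_nonneg pmf_nonneg assms(2)[rule_format] merge_in_states assms)
  then show ?thesis
    using marginal_pos[OF assms(1,3)] by (simp add: zero_le_mult_iff)
qed

text \<open>
  Summing out \<open>b\<close> along with the coordinates outside \<open>S\<close> exhausts a full row of \<open>M\<close>, which leaves
  the denominator of the keep-in matrix.
\<close>

lemma keep_in_row_sum:
  assumes "S \<subseteq> {1..d}" "transition_matrix \<Omega> M" "a \<in> Pi\<^sub>E S X"
  shows "(\<Sum>b\<in>Pi\<^sub>E S X. keep_in d X \<pi> M S a b) = 1"
proof -
  let ?T = "{1..d} - S"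
  have "marginal S a * (\<Sum>b\<in>Pi\<^sub>E S X. keep_in d X \<pi> M S a b)
      = (\<Sum>b\<in>Pi\<^sub>E S X. \<Sum>u\<in>Pi\<^sub>E ?T X. \<Sum>v\<in>Pi\<^sub>E ?T X.
           pmf \<pi> (merge S ?T (a, u)) * M (merge S ?T (a, u)) (merge S ?T (b, v)))"
    by (simp add: sum_distrib_left marginal_mult_keep_in[OF assms(1,3)])
  also have "\<dots> = (\<Sum>u\<in>Pi\<^sub>E ?T X. pmf \<pi> (merge S ?T (a, u)) *
                   (\<Sum>y\<in>\<Omega>. M (merge S ?T (a, u)) y))"
    by (subst sum.swap) (simp add: sum_states_split[OF assms(1)] sum_distrib_left)
  also have "\<dots> = marginal S a"
    unfolding marginal_def
    by (rule sum.cong) (use assms merge_in_states in \<open>auto simp: transition_matrix_def\<close>)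
  finally show ?thesis
    using marginal_pos[OF assms(1,3)] by simp
qed

text \<open>
  The numerator of the keep-in matrix contains the summand \<open>\<pi>(x) M(x, y)\<close>, and \<open>\<pi>\<close> has full support.
\<close>

lemma keep_in_pos:
  assumes "S \<subseteq> {1..d}" "nonneg_on M" "x \<in> \<Omega>" "y \<in> \<Omega>" "M x y \<noteq> 0"
  shows "0 < keep_in d X \<pi> M S (restrict x S) (restrict y S)"
proof -
  let ?T = "{1..d} - S"
  have a: "restrict x S \<in> Pi\<^sub>E S X" and b: "restrict y S \<in> Pi\<^sub>E S X"
    using assms by (auto intro: restrict_in_PiE_sub)
  have u: "restrict x ?T \<in> Pi\<^sub>E ?T X" and v: "restrict y ?T \<in> Pi\<^sub>E ?T X"
    using assms by (auto intro: restrict_in_PiE_sub)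
  have fin: "finite (Pi\<^sub>E ?T X)"
    by (simp add: finite_PiE_sub)
  have nn: "0 \<le> pmf \<pi> (merge S ?T (restrict x S, u')) *
       M (merge S ?T (restrict x S, u')) (merge S ?T (restrict y S, v'))"
    if "u' \<in> Pi\<^sub>E ?T X" "v' \<in> Pi\<^sub>E ?T X" for u' v'
    using merge_in_states[OF assms(1) a that(1)] merge_in_states[OF assms(1) b that(2)] assms(2)
    by simp
  have "0 < marginal S (restrict x S) * keep_in d X \<pi> M S (restrict x S) (restrict y S)"
    unfolding marginal_mult_keep_in[OF assms(1) a]
  proof (rule sum_pos2[OF fin u])
    show "0 < (\<Sum>v\<in>Pi\<^sub>E ?T X. pmf \<pi> (merge S ?T (restrict x S, restrict x ?T)) *
        M (merge S ?T (restrict x S, restrict x ?T)) (merge S ?T (restrict y S, v)))"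
    proof (rule sum_pos2[OF fin v])
      show "0 < pmf \<pi> (merge S ?T (restrict x S, restrict x ?T)) *
        M (merge S ?T (restrict x S, restrict x ?T)) (merge S ?T (restrict y S, restrict y ?T))"
        unfolding merge_restrict_states[OF assms(1,3)] merge_restrict_states[OF assms(1,4)]
        using assms(2-5) pmf_pos[OF assms(3)] by (simp add: less_le)
    qed (use nn[OF u] in auto)
  qed (use nn in \<open>auto intro!: sum_nonneg\<close>)
  then show ?thesis
    using marginal_pos[OF assms(1) a] by (simp add: zero_less_mult_iff)
qed

lemma keep_in_nonzeroE:
  assumes "S \<subseteq> {1..d}" "a \<in> Pi\<^sub>E S X" "b \<in> Pi\<^sub>E S X" "keep_in d X \<pi> M S a b \<noteq> 0"
  obtains x y where "x \<in> \<Omega>" "y \<in> \<Omega>" "restrict x S = a" "restrict y S = b" "M x y \<noteq> 0"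
proof -
  let ?T = "{1..d} - S"
  have "marginal S a * keep_in d X \<pi> M S a b \<noteq> 0"
    using marginal_pos[OF assms(1,2)] assms(4) by simp
  then obtain u where u: "u \<in> Pi\<^sub>E ?T X" and "(\<Sum>v\<in>Pi\<^sub>E ?T X.
       pmf \<pi> (merge S ?T (a, u)) * M (merge S ?T (a, u)) (merge S ?T (b, v))) \<noteq> 0"
    unfolding marginal_mult_keep_in[OF assms(1,2)] by (rule sum.not_neutral_contains_not_neutral)
  then obtain v where v: "v \<in> Pi\<^sub>E ?T X"
    and "pmf \<pi> (merge S ?T (a, u)) * M (merge S ?T (a, u)) (merge S ?T (b, v)) \<noteq> 0"
    by (elim sum.not_neutral_contains_not_neutral)
  then have "M (merge S ?T (a, u)) (merge S ?T (b, v)) \<noteq> 0"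
    by simp
  then show ?thesis
    using that[OF merge_in_states[OF assms(1,2) u] merge_in_states[OF assms(1,3) v]]
      restrict_merge_states[OF assms(2)] restrict_merge_states[OF assms(3)] by blast
qed

text \<open>
  The keep-in matrix is the conditional law of the coordinates in \<open>S\<close> after one step from \<open>\<pi>\<close>,
  given those coordinates before the step. Hence it computes averages of functions
  of these coordinates.
\<close>

lemma sum_keep_in:
  assumes "S \<subseteq> {1..d}"
  shows "(\<Sum>x\<in>\<Omega>. \<Sum>y\<in>\<Omega>. pmf \<pi> x * M x y * f (restrict x S) (restrict y S))
       = (\<Sum>a\<in>Pi\<^sub>E S X. marginal S a * (\<Sum>b\<in>Pi\<^sub>E S X. keep_in d X \<pi> M S a b * f a b))"
proof -
  let ?T = "{1..d} - S"
  have "(\<Sum>x\<in>\<Omega>. \<Sum>y\<in>\<Omega>. pmf \<pi> x * M x y * f (restrict x S) (restrict y S))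
      = (\<Sum>a\<in>Pi\<^sub>E S X. \<Sum>u\<in>Pi\<^sub>E ?T X. \<Sum>b\<in>Pi\<^sub>E S X. \<Sum>v\<in>Pi\<^sub>E ?T X.
           pmf \<pi> (merge S ?T (a, u)) * M (merge S ?T (a, u)) (merge S ?T (b, v)) * f a b)"
    by (simp add: sum_states_split[OF assms] restrict_merge_states)
  also have "\<dots> = (\<Sum>a\<in>Pi\<^sub>E S X. \<Sum>b\<in>Pi\<^sub>E S X. \<Sum>u\<in>Pi\<^sub>E ?T X. \<Sum>v\<in>Pi\<^sub>E ?T X.
           pmf \<pi> (merge S ?T (a, u)) * M (merge S ?T (a, u)) (merge S ?T (b, v)) * f a b)"
    by (intro sum.cong refl sum.swap)
  also have "\<dots> = (\<Sum>a\<in>Pi\<^sub>E S X. \<Sum>b\<in>Pi\<^sub>E S X. (marginal S a * keep_in d X \<pi> M S a b) * f a b)"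
    by (simp add: marginal_mult_keep_in[OF assms] sum_distrib_right)
  finally show ?thesis
    by (simp add: sum_distrib_left mult.assoc)
qed

end

section \<open>Mixtures and their product projections\<close>

locale mixture_family = product_chain d X \<pi>
  for d :: nat and X :: "nat \<Rightarrow> 'a set" and \<pi> :: "(nat \<Rightarrow> 'a) pmf" +
  fixes n m :: nat and P :: "nat \<Rightarrow> (nat \<Rightarrow> 'a) \<Rightarrow> (nat \<Rightarrow> 'a) \<Rightarrow> real" and S :: "nat \<Rightarrow> nat set"
  assumes transition: "i \<in> {1..n} \<Longrightarrow> transition_matrix (Pi\<^sub>E {1..d} X) (P i)"
    and partition: "partition_on {1..d} (S ` {1..m})"
    and inj_blocks: "inj_on S {1..m}"
begin

abbreviation W :: "(nat \<Rightarrow> real) set" where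
  "W \<equiv> simplex_weights n"

abbreviation Q :: "(nat \<Rightarrow> real) \<Rightarrow> (nat \<Rightarrow> 'a) \<Rightarrow> (nat \<Rightarrow> 'a) \<Rightarrow> real" where
  "Q w \<equiv> prod_mixture d X \<pi> n P m S w"

abbreviation L :: "(nat \<Rightarrow> real) \<Rightarrow> nat \<Rightarrow> (nat \<Rightarrow> 'a) \<Rightarrow> (nat \<Rightarrow> 'a) \<Rightarrow> real" where
  "L w k \<equiv> keep_in d X \<pi> (mixture n P w) (S k)"

abbreviation D :: "(nat \<Rightarrow> real) \<Rightarrow> nat \<Rightarrow> ereal" where
  "D \<equiv> div_to_prod d X \<pi> n P m S"

abbreviation Dr :: "(nat \<Rightarrow> real) \<Rightarrow> nat \<Rightarrow> real" where
  "Dr w i \<equiv> KL_real \<Omega> \<pi> (P i) (Q w)"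

lemma Q_eq: "Q w x y = (\<Prod>k\<in>{1..m}. L w k (restrict x (S k)) (restrict y (S k)))"
  by (simp add: prod_mixture_def tensor_def)

lemma block_subset: "k \<in> {1..m} \<Longrightarrow> S k \<subseteq> {1..d}"
  using partition by (auto simp: partition_on_def)

lemma blocks_disjoint: "disjoint_family_on S {1..m}"
  unfolding disjoint_family_on_def
proof (intro ballI impI)
  fix k l assume kl: "k \<in> {1..m}" "l \<in> {1..m}" "k \<noteq> l"
  then have "S k \<noteq> S l"
    using inj_onD[OF inj_blocks] by blast
  moreover have "disjoint (S ` {1..m})"
    using partition by (simp add: partition_on_def)
  ultimately show "S k \<inter> S l = {}"
    using kl disjointD[of "S ` {1..m}" "S k" "S l"] by blast
qed

lemma blocks_union: "(\<Union>k\<in>{1..m}. S k) = {1..d}"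
  using partition by (auto simp: partition_on_def)

lemma P_nonneg: "i \<in> {1..n} \<Longrightarrow> x \<in> \<Omega> \<Longrightarrow> y \<in> \<Omega> \<Longrightarrow> 0 \<le> P i x y"
  using transition by (auto simp: transition_matrix_def)

lemma P_row_sum: "i \<in> {1..n} \<Longrightarrow> x \<in> \<Omega> \<Longrightarrow> (\<Sum>y\<in>\<Omega>. P i x y) = 1"
  using transition by (auto simp: transition_matrix_def)

lemma row_nonzeroE:
  assumes "i \<in> {1..n}" "x \<in> \<Omega>"
  obtains y where "y \<in> \<Omega>" "P i x y \<noteq> 0"
proof -
  have "(\<Sum>y\<in>\<Omega>. P i x y) \<noteq> 0"
    using P_row_sum[OF assms] by simp
  then show ?thesis
    by (rule sum.not_neutral_contains_not_neutral) (rule that)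
qed

lemma mixture_transition:
  assumes "w \<in> W"
  shows "transition_matrix \<Omega> (mixture n P w)"
proof -
  have "(\<Sum>y\<in>\<Omega>. mixture n P w x y) = 1" if "x \<in> \<Omega>" for x
  proof -
    have "(\<Sum>y\<in>\<Omega>. mixture n P w x y) = (\<Sum>i\<in>{1..n}. w i * (\<Sum>y\<in>\<Omega>. P i x y))"
      unfolding mixture_def by (subst sum.swap) (simp add: sum_distrib_left)
    also have "\<dots> = (\<Sum>i\<in>{1..n}. w i)"
      using P_row_sum that by (intro sum.cong) auto
    also have "\<dots> = 1"
      using assms by (simp add: simplex_weights_def)
    finally show ?thesis .
  qed
  then show ?thesis
    using assms P_nonneg
    by (auto simp: transition_matrix_def mixture_def simplex_weights_def intro!: sum_nonneg)
qed

lemma mixture_nonneg: "w \<in> W \<Longrightarrow> nonneg_on (mixture n P w)"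
  using mixture_transition by (auto simp: transition_matrix_def)

lemma L_nonneg:
  "w \<in> W \<Longrightarrow> k \<in> {1..m} \<Longrightarrow> a \<in> Pi\<^sub>E (S k) X \<Longrightarrow> b \<in> Pi\<^sub>E (S k) X \<Longrightarrow> 0 \<le> L w k a b"
  by (intro keep_in_nonneg block_subset mixture_nonneg)

lemma L_row_sum:
  "w \<in> W \<Longrightarrow> k \<in> {1..m} \<Longrightarrow> a \<in> Pi\<^sub>E (S k) X \<Longrightarrow> (\<Sum>b\<in>Pi\<^sub>E (S k) X. L w k a b) = 1"
  by (intro keep_in_row_sum block_subset mixture_transition)

lemma Q_transition:
  assumes "w \<in> W"
  shows "transition_matrix \<Omega> (Q w)"
proof -
  have "(\<Sum>y\<in>\<Omega>. Q w x y) = 1" if "x \<in> \<Omega>" for x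
  proof -
    have "(\<Sum>y\<in>\<Omega>. Q w x y) = (\<Prod>k\<in>{1..m}. \<Sum>b\<in>Pi\<^sub>E (S k) X. L w k (restrict x (S k)) b)"
      using sum_PiE_prod_blocks[OF _ blocks_disjoint, of "\<lambda>k. L w k (restrict x (S k))" X]
      unfolding Q_eq blocks_union by simp
    also have "\<dots> = 1"
      using that assms by (intro prod.neutral ballI L_row_sum restrict_in_PiE_sub block_subset)
    finally show ?thesis .
  qed
  moreover have "0 \<le> Q w x y" if "x \<in> \<Omega>" "y \<in> \<Omega>" for x y
    unfolding Q_eq
    using that assms by (intro prod_nonneg L_nonneg restrict_in_PiE_sub block_subset)
  ultimately show ?thesis
    by (simp add: transition_matrix_def)
qed

text \<open>
  Projecting preserves positivity, so the product of the projections charges every transition that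
  the mixture charges. This keeps \<open>h\<close> finite.
\<close>

lemma mixture_abs_cont_Q:
  assumes "w \<in> W"
  shows "abs_cont_on \<Omega> (mixture n P w) (Q w)"
  unfolding abs_cont_on_def
proof (intro ballI impI)
  fix x y assume "x \<in> \<Omega>" "y \<in> \<Omega>" "mixture n P w x y \<noteq> 0"
  then have "0 < Q w x y"
    unfolding Q_eq using assms
    by (intro prod_pos keep_in_pos mixture_nonneg block_subset)
  then show "Q w x y \<noteq> 0"
    by simp
qed

lemma mixture_nonzero_iff:
  assumes "w \<in> W" "x \<in> \<Omega>" "y \<in> \<Omega>"
  shows "mixture n P w x y \<noteq> 0 \<longleftrightarrow> (\<exists>i\<in>{1..n}. w i \<noteq> 0 \<and> P i x y \<noteq> 0)"
proof -
  have "\<forall>i\<in>{1..n}. 0 \<le> w i * P i x y"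
    using assms P_nonneg by (auto simp: simplex_weights_def)
  then show ?thesis
    unfolding mixture_def by (subst sum_nonneg_eq_0_iff) auto
qed

lemma abs_cont_mixture_iff:
  assumes "w \<in> W"
  shows "abs_cont_on \<Omega> (mixture n P w) K \<longleftrightarrow> (\<forall>i\<in>{1..n}. w i \<noteq> 0 \<longrightarrow> abs_cont_on \<Omega> (P i) K)"
proof -
  have "abs_cont_on \<Omega> (mixture n P w) K \<longleftrightarrow>
      (\<forall>x\<in>\<Omega>. \<forall>y\<in>\<Omega>. (\<exists>i\<in>{1..n}. w i \<noteq> 0 \<and> P i x y \<noteq> 0) \<longrightarrow> K x y \<noteq> 0)"
    unfolding abs_cont_on_def by (intro ball_cong refl) (simp only: mixture_nonzero_iff[OF assms])
  also have "\<dots> \<longleftrightarrow> (\<forall>i\<in>{1..n}. w i \<noteq> 0 \<longrightarrow> abs_cont_on \<Omega> (P i) K)"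
    unfolding abs_cont_on_def by blast
  finally show ?thesis .
qed

lemma D_eq: "abs_cont_on \<Omega> (P i) (Q v) \<Longrightarrow> D v i = ereal (Dr v i)"
  by (simp add: div_to_prod_def KL_eq_KL_real)

lemma D_infinite: "\<not> abs_cont_on \<Omega> (P i) (Q v) \<Longrightarrow> D v i = \<infinity>"
  by (simp add: div_to_prod_def KL_eq_PInfty finite_states full_support)

lemma D_finite_iff: "D v i \<noteq> \<infinity> \<longleftrightarrow> abs_cont_on \<Omega> (P i) (Q v)"
  using D_eq D_infinite by fastforce

lemma abs_cont_self:
  assumes "v \<in> W" "i \<in> {1..n}" "v i \<noteq> 0"
  shows "abs_cont_on \<Omega> (P i) (Q v)"
  using mixture_abs_cont_Q[OF assms(1)] abs_cont_mixture_iff[OF assms(1)] assms by blast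

lemma Dr_nonneg:
  assumes "v \<in> W" "i \<in> {1..n}" "abs_cont_on \<Omega> (P i) (Q v)"
  shows "0 \<le> Dr v i"
  using Q_transition[OF assms(1)] transition[OF assms(2)] assms(3)
  by (intro KL_real_nonneg) (auto simp: transition_matrix_def)

lemma D_nonneg: "v \<in> W \<Longrightarrow> i \<in> {1..n} \<Longrightarrow> 0 \<le> D v i"
  using D_eq D_infinite Dr_nonneg by (cases "abs_cont_on \<Omega> (P i) (Q v)") auto

text \<open>
  Indices with \<open>w i = 0\<close> may have infinite divergence; they drop out because \<open>0 * \<infinity> = 0\<close>.
\<close>

lemma weighted_D_sum:
  assumes "w \<in> W" "abs_cont_on \<Omega> (mixture n P w) (Q v)"
  shows "(\<Sum>i\<in>{1..n}. ereal (w i) * D v i) = ereal (\<Sum>i\<in>{1..n}. w i * Dr v i)"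
proof -
  have "ereal (w i) * D v i = ereal (w i * Dr v i)" if i: "i \<in> {1..n}" for i
  proof (cases "w i = 0")
    case False
    then have "abs_cont_on \<Omega> (P i) (Q v)"
      using assms i abs_cont_mixture_iff[OF assms(1)] by blast
    then show ?thesis
      by (simp add: D_eq)
  qed (simp add: zero_ereal_def[symmetric])
  then show ?thesis
    by simp
qed

lemma h_eq: "v \<in> W \<Longrightarrow> h_fun d X \<pi> n P m S v = ereal (- (\<Sum>i\<in>{1..n}. v i * Dr v i))"
  by (simp add: h_fun_def weighted_D_sum mixture_abs_cont_Q)

text \<open>
  Absolute continuity on the full space descends to every block, so that Gibbs' inequality is
  applicable there: a positive entry of a keep-in matrix comes from some positive entry of the mixture,
  where \<open>Q v\<close>, and with it each of its factors, is nonzero.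
\<close>

lemma L_abs_cont:
  assumes "w \<in> W" "abs_cont_on \<Omega> (mixture n P w) (Q v)" "k \<in> {1..m}"
    and "a \<in> Pi\<^sub>E (S k) X" "b \<in> Pi\<^sub>E (S k) X" "L w k a b \<noteq> 0"
  shows "L v k a b \<noteq> 0"
proof -
  obtain x y where xy: "x \<in> \<Omega>" "y \<in> \<Omega>" "restrict x (S k) = a" "restrict y (S k) = b"
      "mixture n P w x y \<noteq> 0"
    by (rule keep_in_nonzeroE[OF block_subset[OF assms(3)] assms(4-6)])
  have "Q v x y \<noteq> 0"
    using assms(2) xy(1,2,5) unfolding abs_cont_on_def by blast
  then have "L v k (restrict x (S k)) (restrict y (S k)) \<noteq> 0"
    using assms(3) unfolding Q_eq prod_zero_iff[OF finite_atLeastAtMost] by blast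
  then show ?thesis
    by (simp only: xy(3,4) not_False_eq_True)
qed

text \<open>
  The Pythagorean identity. The logarithm of \<open>Q w x y / Q v x y\<close> splits over the blocks, and the
  summand of a block sees \<open>x\<close> and \<open>y\<close> only through that block, so its average is one under the
  keep-in matrix \<open>L w k\<close>. All logarithms may be manipulated freely, since transitions on which
  the mixture vanishes carry weight zero and on all others both products are positive.
\<close>

lemma weighted_Dr_difference:
  assumes w: "w \<in> W" and v: "v \<in> W" and ac: "abs_cont_on \<Omega> (mixture n P w) (Q v)"
  shows "(\<Sum>i\<in>{1..n}. w i * Dr v i) - (\<Sum>i\<in>{1..n}. w i * Dr w i)
       = (\<Sum>k\<in>{1..m}. \<Sum>a\<in>Pi\<^sub>E (S k) X. marginal (S k) a *
            (\<Sum>b\<in>Pi\<^sub>E (S k) X. L w k a b * ln (L w k a b / L v k a b)))"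
proof -
  let ?r = "\<lambda>k x y. ln (L w k (restrict x (S k)) (restrict y (S k)) /
                       L v k (restrict x (S k)) (restrict y (S k)))"
  have Qpos: "0 < Q w x y \<and> 0 < Q v x y" if "x \<in> \<Omega>" "y \<in> \<Omega>" "mixture n P w x y \<noteq> 0" for x y
    using that ac mixture_abs_cont_Q[OF w] Q_transition[OF w] Q_transition[OF v]
    by (auto simp: abs_cont_on_def transition_matrix_def less_le)
  have term_eq: "w i * (P i x y * ln (P i x y / Q v x y)) - w i * (P i x y * ln (P i x y / Q w x y))
      = w i * P i x y * ln (Q w x y / Q v x y)" if "x \<in> \<Omega>" "y \<in> \<Omega>" "i \<in> {1..n}" for i x y
  proof (cases "w i * P i x y = 0")
    case False
    then have "mixture n P w x y \<noteq> 0" "0 < P i x y"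
      using that P_nonneg[OF that(3,1,2)] by (auto simp: mixture_nonzero_iff[OF w])
    then show ?thesis
      using Qpos[OF that(1,2)] by (simp add: ln_div algebra_simps)
  qed auto
  have split: "mixture n P w x y * ln (Q w x y / Q v x y) = (\<Sum>k\<in>{1..m}. mixture n P w x y * ?r k x y)"
    if xy: "x \<in> \<Omega>" "y \<in> \<Omega>" for x y
  proof (cases "mixture n P w x y = 0")
    case False
    have "Q w x y \<noteq> 0" "Q v x y \<noteq> 0"
      using Qpos[OF xy False] by auto
    moreover have "0 \<le> L u k (restrict x (S k)) (restrict y (S k))" if "u \<in> W" "k \<in> {1..m}" for u k
      using that xy by (intro L_nonneg restrict_in_PiE_sub block_subset)
    ultimately have ratio_pos: "0 < L w k (restrict x (S k)) (restrict y (S k)) /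
                       L v k (restrict x (S k)) (restrict y (S k))" if "k \<in> {1..m}" for k
      using that w v unfolding Q_eq by (auto simp: less_le simp del: atLeastAtMost_iff)
    have "ln (Q w x y / Q v x y) = (\<Sum>k\<in>{1..m}. ?r k x y)"
      unfolding Q_eq prod_dividef[symmetric]
      by (rule ln_prod[OF finite_atLeastAtMost]) (rule less_imp_neq[OF ratio_pos, symmetric])
    then show ?thesis
      by (simp add: sum_distrib_left)
  qed simp
  \<comment> \<open>Cancel \<open>P i ln (P i)\<close>, form the mixture, split the logarithm over the blocks, and marginalise
      each block.\<close>
  have "(\<Sum>i\<in>{1..n}. w i * Dr v i) - (\<Sum>i\<in>{1..n}. w i * Dr w i)
      = (\<Sum>i\<in>{1..n}. \<Sum>x\<in>\<Omega>. \<Sum>y\<in>\<Omega>. pmf \<pi> x * (w i * (P i x y * ln (P i x y / Q v x y))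
            - w i * (P i x y * ln (P i x y / Q w x y))))"
    unfolding KL_real_def
    by (simp add: sum_distrib_left sum_subtractf right_diff_distrib mult.left_commute)
  also have "\<dots> = (\<Sum>i\<in>{1..n}. \<Sum>x\<in>\<Omega>. \<Sum>y\<in>\<Omega>. pmf \<pi> x * (w i * P i x y * ln (Q w x y / Q v x y)))"
    by (intro sum.cong refl arg_cong2[where f = "(*)"] term_eq)
  also have "\<dots> = (\<Sum>x\<in>\<Omega>. \<Sum>y\<in>\<Omega>. \<Sum>i\<in>{1..n}. pmf \<pi> x * (w i * P i x y * ln (Q w x y / Q v x y)))"
    by (subst sum.swap) (intro sum.cong refl sum.swap)
  also have "\<dots> = (\<Sum>x\<in>\<Omega>. \<Sum>y\<in>\<Omega>. pmf \<pi> x * (mixture n P w x y * ln (Q w x y / Q v x y)))"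
    by (simp add: mixture_def sum_distrib_left sum_distrib_right)
  also have "\<dots> = (\<Sum>x\<in>\<Omega>. \<Sum>y\<in>\<Omega>. \<Sum>k\<in>{1..m}. pmf \<pi> x * mixture n P w x y * ?r k x y)"
    by (intro sum.cong refl) (simp add: split sum_distrib_left mult.assoc)
  also have "\<dots> = (\<Sum>k\<in>{1..m}. \<Sum>x\<in>\<Omega>. \<Sum>y\<in>\<Omega>. pmf \<pi> x * mixture n P w x y * ?r k x y)"
    by (subst sum.swap[of _ _ "{1..m}"], subst sum.swap) (intro sum.cong refl sum.swap)
  also have "\<dots> = (\<Sum>k\<in>{1..m}. \<Sum>a\<in>Pi\<^sub>E (S k) X. marginal (S k) a *
            (\<Sum>b\<in>Pi\<^sub>E (S k) X. L w k a b * ln (L w k a b / L v k a b)))"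
    by (intro sum.cong refl sum_keep_in block_subset)
  finally show ?thesis .
qed

lemma own_projection_optimal:
  assumes "w \<in> W" "v \<in> W" "abs_cont_on \<Omega> (mixture n P w) (Q v)"
  shows "(\<Sum>i\<in>{1..n}. w i * Dr w i) \<le> (\<Sum>i\<in>{1..n}. w i * Dr v i)"
proof -
  have "0 \<le> (\<Sum>k\<in>{1..m}. \<Sum>a\<in>Pi\<^sub>E (S k) X. marginal (S k) a *
            (\<Sum>b\<in>Pi\<^sub>E (S k) X. L w k a b * ln (L w k a b / L v k a b)))"
  proof (rule sum_nonneg, rule sum_nonneg, rule mult_nonneg_nonneg)
    fix k a assume k: "k \<in> {1..m}" and a: "a \<in> Pi\<^sub>E (S k) X"
    show "0 \<le> marginal (S k) a"
      using marginal_pos[OF block_subset[OF k] a] by simp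
    show "0 \<le> (\<Sum>b\<in>Pi\<^sub>E (S k) X. L w k a b * ln (L w k a b / L v k a b))"
      using assms k a
      by (intro Gibbs_inequality L_nonneg L_abs_cont[OF assms(1,3) k a]) (simp_all add: L_row_sum)
  qed
  then show ?thesis
    using weighted_Dr_difference[OF assms] by simp
qed

section \<open>Subgradient inequality and norm bound\<close>

text \<open>
  The constant \<open>c\<close> is arbitrary because \<open>w\<close> and \<open>v\<close> have the same total mass; the choice
  \<open>c = Dr v n\<close> gives the vector \<open>g\<close>.
\<close>

lemma subgradient_inequality:
  assumes v: "v \<in> W" and w: "w \<in> W" and ac: "abs_cont_on \<Omega> (mixture n P w) (Q v)"
  shows "- (\<Sum>i\<in>{1..n}. v i * Dr v i) + (\<Sum>i\<in>{1..n}. (c - Dr v i) * (w i - v i))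
       \<le> - (\<Sum>i\<in>{1..n}. w i * Dr w i)"
proof -
  have "(\<Sum>i\<in>{1..n}. (c - Dr v i) * (w i - v i))
      = (\<Sum>i\<in>{1..n}. c * w i - c * v i - w i * Dr v i + v i * Dr v i)"
    by (simp add: algebra_simps)
  also have "\<dots> = c * sum w {1..n} - c * sum v {1..n} - (\<Sum>i\<in>{1..n}. w i * Dr v i) + (\<Sum>i\<in>{1..n}. v i * Dr v i)"
    by (simp add: sum.distrib sum_subtractf sum_distrib_left)
  finally show ?thesis
    using own_projection_optimal[OF w v ac] v w by (simp add: simplex_weights_def)
qed

text \<open>
  If the divergence of \<open>P i\<close> from \<open>Q v\<close> is infinite, then \<open>v i = 0\<close> and the \<open>i\<close>-th entry of \<open>g\<close> is
  \<open>- \<infinity>\<close>. Its contribution is \<open>0\<close> if \<open>w i = 0\<close>, which reduces to the finite case, and \<open>- \<infinity>\<close>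
  otherwise, which makes the whole lower bound \<open>- \<infinity>\<close>.
\<close>

lemma subgradient_inequality_ereal:
  assumes v: "v \<in> W" and w: "w \<in> W" and n: "D v n \<noteq> \<infinity>"
  shows "h_fun d X \<pi> n P m S v + (\<Sum>i\<in>{1..n}. g_vec d X \<pi> n P m S v i * ereal (w i - v i))
         \<le> h_fun d X \<pi> n P m S w"
proof -
  let ?t = "\<lambda>i. g_vec d X \<pi> n P m S v i * ereal (w i - v i)"
  have Dn: "D v n = ereal (Dr v n)"
    using n D_finite_iff D_eq by blast
  have t_fin: "?t i = ereal ((Dr v n - Dr v i) * (w i - v i))"
    if "i \<in> {1..n}" "w i \<noteq> 0 \<longrightarrow> abs_cont_on \<Omega> (P i) (Q v)" for i
  proof (cases "abs_cont_on \<Omega> (P i) (Q v)")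
    case True
    then show ?thesis by (simp add: g_vec_def Dn D_eq)
  next
    case False
    then have "w i = 0" "v i = 0"
      using that abs_cont_self[OF v that(1)] by auto
    then show ?thesis by (simp add: zero_ereal_def[symmetric])
  qed
  have t_inf: "?t i = -\<infinity>" if "i \<in> {1..n}" "w i \<noteq> 0" "\<not> abs_cont_on \<Omega> (P i) (Q v)" for i
  proof -
    have "v i = 0" "0 < w i"
      using that w abs_cont_self[OF v that(1)] by (auto simp: simplex_weights_def less_le)
    then show ?thesis
      using that(3) by (simp add: g_vec_def Dn D_infinite)
  qed
  show ?thesis
  proof (cases "abs_cont_on \<Omega> (mixture n P w) (Q v)")
    case True
    then have "sum ?t {1..n} = ereal (\<Sum>i\<in>{1..n}. (Dr v n - Dr v i) * (w i - v i))"
      using t_fin abs_cont_mixture_iff[OF w] by simp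
    then show ?thesis
      using subgradient_inequality[OF v w True, of "Dr v n"] by (simp add: h_eq v w)
  next
    case False
    then obtain j where j: "j \<in> {1..n}" "?t j = -\<infinity>"
      using abs_cont_mixture_iff[OF w] t_inf by blast
    have "?t i \<noteq> \<infinity>" if "i \<in> {1..n}" for i
    proof (cases "w i \<noteq> 0 \<longrightarrow> abs_cont_on \<Omega> (P i) (Q v)")
      case True
      show ?thesis
        unfolding t_fin[OF that True] by (rule PInfty_neq_ereal(1))
    next
      case False
      then have minf: "?t i = -\<infinity>"
        using t_inf[OF that] by blast
      show ?thesis
        unfolding minf by simp
    qed
    then have "sum ?t ({1..n} - {j}) \<noteq> \<infinity>"
      by (subst sum_Pinfty) blast
    moreover have "sum ?t {1..n} = -\<infinity> + sum ?t ({1..n} - {j})"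
      unfolding sum.remove[OF finite_atLeastAtMost j(1)] j(2) ..
    ultimately have "sum ?t {1..n} = -\<infinity>"
      by (cases "sum ?t ({1..n} - {j})") simp_all
    then show ?thesis
      by (simp add: h_eq v)
  qed
qed

text \<open>
  Only transitions with \<open>P i x y > 0\<close> are bounded by \<open>M\<close>, so replacing the zero entries of a row by
  \<open>M\<close> requires \<open>0 \<le> M\<close>. This follows from \<open>0 \<le> D v i\<close>: were \<open>M\<close> negative, every row would contribute
  a negative amount.
\<close>

lemma D_le_card_mult_bound:
  assumes v: "v \<in> W" and i: "i \<in> {1..n}"
    and le: "\<And>x y. x \<in> \<Omega> \<Longrightarrow> y \<in> \<Omega> \<Longrightarrow> P i x y > 0 \<Longrightarrow> xln_ratio (P i x y) (Q v x y) \<le> M"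
  shows "0 \<le> M \<and> D v i \<le> ereal (real (card \<Omega>)) * M"
proof (cases "abs_cont_on \<Omega> (P i) (Q v)")
  case False
  then obtain x y where xy: "x \<in> \<Omega>" "y \<in> \<Omega>" "P i x y \<noteq> 0" "Q v x y = 0"
    by (auto simp: abs_cont_on_def)
  then have "M = \<infinity>"
    using le[OF xy(1,2)] P_nonneg[OF i xy(1,2)] by (auto simp: xln_ratio_def)
  moreover have "0 < card \<Omega>"
    using finite_states states_nonempty by (simp add: card_gt_0_iff)
  ultimately show ?thesis by simp
next
  case True
  have le': "ereal (P i x y * ln (P i x y / Q v x y)) \<le> M" if "x \<in> \<Omega>" "y \<in> \<Omega>" "P i x y \<noteq> 0" for x y
    using le[OF that(1,2)] P_nonneg[OF i that(1,2)] that True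
    by (auto simp: xln_ratio_def abs_cont_on_def)
  obtain x where x: "x \<in> \<Omega>"
    using states_nonempty by blast
  obtain y where y: "y \<in> \<Omega>" "P i x y \<noteq> 0"
    by (rule row_nonzeroE[OF i x])
  show ?thesis
  proof (cases M)
    case PInf
    moreover have "0 < card \<Omega>"
      using finite_states states_nonempty by (simp add: card_gt_0_iff)
    ultimately show ?thesis by simp
  next
    case MInf
    then show ?thesis
      using le'[OF x y] by simp
  next
    case (real r)
    then have le_r: "P i x y * ln (P i x y / Q v x y) \<le> r" if "x \<in> \<Omega>" "y \<in> \<Omega>" "P i x y \<noteq> 0" for x y
      using le'[OF that] by simp
    have r: "0 \<le> r"
    proof (rule ccontr)
      assume "\<not> 0 \<le> r"
      then have "r < 0" by simp
      have neg: "(\<Sum>y\<in>\<Omega>. P i x y * ln (P i x y / Q v x y)) < 0" if x: "x \<in> \<Omega>" for x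
      proof -
        have lt: "P i x y * ln (P i x y / Q v x y) < 0" if "y \<in> \<Omega>" "P i x y \<noteq> 0" for y
          using le_r[OF x that] \<open>r < 0\<close> by (rule order.strict_trans1)
        obtain y where y: "y \<in> \<Omega>" "P i x y \<noteq> 0"
          by (rule row_nonzeroE[OF i x])
        have "(\<Sum>y\<in>\<Omega>. P i x y * ln (P i x y / Q v x y)) < (\<Sum>y\<in>\<Omega>. 0)"
        proof (rule sum_strict_mono_ex1[OF finite_states])
          show "\<forall>y\<in>\<Omega>. P i x y * ln (P i x y / Q v x y) \<le> 0"
          proof
            fix y assume "y \<in> \<Omega>"
            then show "P i x y * ln (P i x y / Q v x y) \<le> 0"
              using lt[of y] by (cases "P i x y = 0") simp_all
          qed
          show "\<exists>y\<in>\<Omega>. P i x y * ln (P i x y / Q v x y) < 0"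
            using lt[OF y] y(1) by blast
        qed
        then show ?thesis by simp
      qed
      have "Dr v i < (\<Sum>x\<in>\<Omega>. 0)"
        unfolding KL_real_def using neg pmf_pos
        by (intro sum_strict_mono finite_states states_nonempty) (auto simp: mult_pos_neg)
      then show False
        using Dr_nonneg[OF v i True] by simp
    qed
    have "Dr v i \<le> (\<Sum>x\<in>\<Omega>. pmf \<pi> x * (\<Sum>y\<in>\<Omega>. r))"
      unfolding KL_real_def
    proof (intro sum_mono mult_left_mono)
      fix x y assume "x \<in> \<Omega>" "y \<in> \<Omega>"
      then show "P i x y * ln (P i x y / Q v x y) \<le> r"
        using le_r r by (cases "P i x y = 0") auto
    qed simp
    also have "\<dots> = card \<Omega> * r"
      by (simp add: sum_distrib_right[symmetric] sum_pmf)
    finally show ?thesis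
      using r real True by (simp add: D_eq)
  qed
qed

lemma ereal_diff_power2_le:
  fixes a b c :: ereal
  assumes "0 \<le> a" "0 \<le> b" "a \<le> c" "b \<le> c"
  shows "(a - b)\<^sup>2 \<le> c\<^sup>2"
proof (cases c)
  case (real r)
  then obtain p q where pq: "a = ereal p" "b = ereal q"
    using assms by (cases a; cases b) auto
  then have "\<bar>p - q\<bar> \<le> \<bar>r\<bar>"
    using assms real by auto
  then have "(p - q)\<^sup>2 \<le> r\<^sup>2"
    by (rule abs_le_square_iff[THEN iffD1])
  then show ?thesis
    using pq real by simp
qed (use assms in auto)

lemma sum_g_power2_le_B:
  assumes v: "v \<in> W" and n: "n \<ge> 1"
  shows "(\<Sum>i\<in>{1..n}. (g_vec d X \<pi> n P m S v i)\<^sup>2) \<le> B_bound d X \<pi> n P m S"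
proof -
  define M where "M = Sup {xln_ratio (P i x y) (Q v x y) | v i x y.
             v \<in> W \<and> i \<in> {1..n} \<and> x \<in> \<Omega> \<and> y \<in> \<Omega> \<and> P i x y > 0}"
  let ?C = "ereal (real (card \<Omega>)) * M"
  have "xln_ratio (P i x y) (Q v x y) \<le> M" if "i \<in> {1..n}" "x \<in> \<Omega>" "y \<in> \<Omega>" "P i x y > 0" for i x y
    unfolding M_def by (rule Sup_upper) (use v that in blast)
  then have D_le: "D v i \<le> ?C" if "i \<in> {1..n}" for i
    using D_le_card_mult_bound[OF v that] that by blast
  have "(\<Sum>i\<in>{1..n}. (g_vec d X \<pi> n P m S v i)\<^sup>2) \<le> (\<Sum>i\<in>{1..n}. ?C\<^sup>2)"
  proof (rule sum_mono)
    fix i assume "i \<in> {1..n}"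
    then show "(g_vec d X \<pi> n P m S v i)\<^sup>2 \<le> ?C\<^sup>2"
      unfolding g_vec_def using n by (intro ereal_diff_power2_le D_nonneg D_le v) auto
  qed
  also have "\<dots> = ereal (real n) * ?C\<^sup>2"
    by (simp add: sum_constant_ereal mult.commute)
  finally show ?thesis
    unfolding B_bound_def M_def .
qed

end

theorem theorem5p1:
  fixes d n m :: nat
    and X :: "nat \<Rightarrow> 'a set"
    and \<pi> :: "(nat \<Rightarrow> 'a) pmf"
    and P :: "nat \<Rightarrow> (nat \<Rightarrow> 'a) \<Rightarrow> (nat \<Rightarrow> 'a) \<Rightarrow> real"
    and S :: "nat \<Rightarrow> nat set"
  defines "h \<equiv> h_fun d X \<pi> n P m S"
    and "g \<equiv> g_vec d X \<pi> n P m S"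
    and "D \<equiv> div_to_prod d X \<pi> n P m S"
  assumes "\<And>i. i \<in> {1..d} \<Longrightarrow> finite (X i)"
    and "set_pmf \<pi> = Pi\<^sub>E {1..d} X"
    and "n \<ge> 1"
    and "\<And>i. i \<in> {1..n} \<Longrightarrow> transition_matrix (Pi\<^sub>E {1..d} X) (P i)"
    and "\<And>i. i \<in> {1..n} \<Longrightarrow> stationary (Pi\<^sub>E {1..d} X) \<pi> (P i)"
    and "partition_on {1..d} (S ` {1..m})" and "inj_on S {1..m}"
  shows "\<forall>v\<in>simplex_weights n.
      \<bar>h v\<bar> \<noteq> \<infinity>
    \<and> ((\<forall>i\<in>{1..n}. v i > 0) \<longrightarrow> (\<forall>i\<in>{1..n}. \<bar>g v i\<bar> \<noteq> \<infinity>))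
    \<and> ((\<forall>i\<in>{1..n}. \<bar>g v i\<bar> \<noteq> \<infinity>) \<longrightarrow>
          is_subgradient n (simplex_weights n) h v (\<lambda>i. real_of_ereal (g v i))
        \<and> ereal ((L2_set (\<lambda>i. real_of_ereal (g v i)) {1..n})\<^sup>2) = (\<Sum>i\<in>{1..n}. (g v i)\<^sup>2))
    \<and> (D v n \<noteq> \<infinity> \<longrightarrow>
          (\<forall>w\<in>simplex_weights n. h w \<ge> h v + (\<Sum>i\<in>{1..n}. g v i * ereal (w i - v i))))
    \<and> (\<Sum>i\<in>{1..n}. (g v i)\<^sup>2) \<le> B_bound d X \<pi> n P m S"
proof -
  interpret mixture_family d X \<pi> n m P S
    by unfold_locales (use assms in auto)
  show ?thesis
  proof (intro ballI conjI impI)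
    fix v assume v: "v \<in> simplex_weights n"
    show h_fin: "\<bar>h v\<bar> \<noteq> \<infinity>"
      by (simp add: h_def h_eq v)
    show ineq: "h w \<ge> h v + (\<Sum>i\<in>{1..n}. g v i * ereal (w i - v i))"
      if "D v n \<noteq> \<infinity>" "w \<in> simplex_weights n" for w
      using subgradient_inequality_ereal[OF v that(2)] that(1) by (simp add: h_def g_def D_def)
    show "(\<Sum>i\<in>{1..n}. (g v i)\<^sup>2) \<le> B_bound d X \<pi> n P m S"
      unfolding g_def using v \<open>n \<ge> 1\<close> by (rule sum_g_power2_le_B)
    show "\<bar>g v i\<bar> \<noteq> \<infinity>" if pos: "\<forall>i\<in>{1..n}. v i > 0" and i: "i \<in> {1..n}" for i
    proof -
      have "abs_cont_on \<Omega> (P j) (Q v)" if "j \<in> {1..n}" for j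
        using abs_cont_self[OF v that] pos that by force
      then show ?thesis
        using i \<open>n \<ge> 1\<close> by (simp add: g_def g_vec_def D_eq)
    qed
    assume fin: "\<forall>i\<in>{1..n}. \<bar>g v i\<bar> \<noteq> \<infinity>"
    have gr: "g v i = ereal (real_of_ereal (g v i))" if "i \<in> {1..n}" for i
      using fin that by (simp add: ereal_real)
    have "D v n \<noteq> \<infinity>"
      using fin \<open>n \<ge> 1\<close> by (force simp: g_def g_vec_def D_def)
    moreover have "(\<Sum>i\<in>{1..n}. g v i * ereal (w i - v i))
        = ereal (\<Sum>i\<in>{1..n}. real_of_ereal (g v i) * (w i - v i))" for w
      unfolding sum_ereal[symmetric] by (intro sum.cong refl) (subst gr, simp_all)
    ultimately show "is_subgradient n (simplex_weights n) h v (\<lambda>i. real_of_ereal (g v i))"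
      using v h_fin ineq by (simp add: is_subgradient_def)
    have "(\<Sum>i\<in>{1..n}. (g v i)\<^sup>2) = ereal (\<Sum>i\<in>{1..n}. (real_of_ereal (g v i))\<^sup>2)"
      unfolding sum_ereal[symmetric] by (intro sum.cong refl) (subst gr, simp_all)
    then show "ereal ((L2_set (\<lambda>i. real_of_ereal (g v i)) {1..n})\<^sup>2) = (\<Sum>i\<in>{1..n}. (g v i)\<^sup>2)"
      by (simp add: L2_set_def sum_nonneg)
  qed
qed

end
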